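(* Let $W$ and $X$ be real matrices for which the product $WX$ is defined, and let $k$ be a truncation rank. If $U_s, S_s, V_s$ are obtained by the singular value decomposition of $XX^T$ (so $XX^T = U_s S_s V_s$), and $U_{ws}, S_{ws}, V_{ws}$ are obtained by the singular value decomposition of $W U_s \sqrt{S_s}$ (so $W U_s\sqrt{S_s} = U_{ws} S_{ws} V_{ws}$), then the compressed weight matrix $$W' = U_{ws}\, \mathrm{Trunc}(S_{ws})\, V_{ws}\, \sqrt{S_s}^{\,-1}\, U_s^{-1}$$ ensures the theoretical minimum truncation loss, i.e. $\|WX - W'X\|_F = L_{\min}$.
   Context: $W$ is a weight matrix of a language model and $X$ is its input activation. $\|\cdot\|_F$ is the Frobenius norm. A singular value decomposition of a matrix $A$ is written $A = U S V$, with $U$, $V$ the matrices of singular vectors and $S$ the diagonal matrix of singular values (so $V$ here stands for what is often written $V^T$). $\sqrt{S_s}$ is the entrywise square root of the diagonal matrix $S_s$, and $\sqrt{S_s}^{\,-1}$ is its inverse. The statement writes this inverse without stating any hypothesis on $X$ or on $XX^T$. $\mathrm{Trunc}(\cdot)$ denotes the rank-$k$ truncation used in SVD compression: the $k$ largest singular values are kept and the smallest ones are truncated (set to zero), where $k$ is determined by the target compression ratio. The truncation loss of a compressed matrix $W'$ replacing $W$ is $L = \|WX - W'X\|_F$. The theoretical minimum truncation loss is $L_{\min} = \|C - C'\|_F$, where $C = WX$ and $C'$ is the version of $C$ compressed by SVD, i.e. its rank-$k$ SVD truncation.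
   Formalization: The formal statement assumes that √S_s is invertible (equivalently, XXᵀ is nonsingular) and that U_s is square, since otherwise the inverses √S_s⁻¹ and U_s⁻¹ in the formula for W' are undefined (for example when X = 0). *)

theory Defs
  imports Complex_Main "Jordan_Normal_Form.Gauss_Jordan_Elimination"
begin

definition frobenius_norm :: "real mat \<Rightarrow> real" where
  "frobenius_norm A = sqrt (\<Sum>i<dim_row A. \<Sum>j<dim_col A. (A $$ (i, j))\<^sup>2)"

(* A = U S V, where V is what is often written V^T: its rows are the right singular vectors.
   The shapes of U and V are left open between the usual variants: square U and V give the full
   decomposition (S is then rectangular of the shape of A), a square S gives the thin or the
   compact one. The singular values are listed in nonincreasing order. *)
definition is_svd :: "real mat \<Rightarrow> real mat \<Rightarrow> real mat \<Rightarrow> real mat \<Rightarrow> bool" where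
  "is_svd A U S V \<longleftrightarrow>
     U \<in> carrier_mat (dim_row A) (dim_row S) \<and>
     V \<in> carrier_mat (dim_col S) (dim_col A) \<and>
     U\<^sup>T * U = 1\<^sub>m (dim_row S) \<and>
     V * V\<^sup>T = 1\<^sub>m (dim_col S) \<and>
     diagonal_mat S \<and>
     (\<forall>i < min (dim_row S) (dim_col S). 0 \<le> S $$ (i, i)) \<and>
     (\<forall>j < min (dim_row S) (dim_col S). \<forall>i \<le> j. S $$ (j, j) \<le> S $$ (i, i)) \<and>
     A = U * S * V"

(* As is_svd orders the singular values, the k largest are the leading k diagonal entries. *)
definition Trunc :: "nat \<Rightarrow> real mat \<Rightarrow> real mat" where
  "Trunc k S = mat (dim_row S) (dim_col S) (\<lambda>(i, j). if i < k then S $$ (i, j) else 0)"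

(* A relation rather than a function: if the k-th and (k+1)-st singular values coincide and are
   nonzero, the truncation depends on the chosen decomposition. *)
definition is_svd_truncation :: "nat \<Rightarrow> real mat \<Rightarrow> real mat \<Rightarrow> bool" where
  "is_svd_truncation k A B \<longleftrightarrow> (\<exists>U S V. is_svd A U S V \<and> B = U * Trunc k S * V)"

(* mat_inverse is option-valued; this is the inverse only when A is invertible. *)
definition mat_inv :: "real mat \<Rightarrow> real mat" where
  "mat_inv A = the (mat_inverse A)"

end

theory Submission
  imports Defs "Jordan_Normal_Form.Determinant"
begin

text \<open>Invertibility of \<open>Ss\<close> forces \<open>Vs = Us\<^sup>T\<close>, so \<open>Z = sqrt(Ss)\<^sup>-\<^sup>1 Us\<^sup>T X\<close> has orthonormal rows,
  and \<open>W X = (W Us sqrt(Ss)) Z\<close>. Hence \<open>Uws, Sws, Vws Z\<close> is a singular value decomposition of \<open>W X\<close>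
  whose rank-\<open>k\<close> truncation is \<open>W' X\<close>. It remains to see that the truncation loss does not depend on
  the decomposition: by the Ky Fan argument, Bessel's inequality bounds the sum of the \<open>k\<close> leading
  squared singular values of one decomposition by that of any other.\<close>

section \<open>Matrix algebra under dimension equations, and diagonal matrices\<close>

text \<open>Dimension equations in place of carrier membership leave no dimension to be guessed, so
  the rule serves \<open>simp\<close> as a conditional rewrite that nests products to the
  right.\<close>

lemma mult_assoc_dim:
  fixes A B C :: "'a :: semiring_0 mat"
  shows "dim_col A = dim_row B \<Longrightarrow> dim_col B = dim_row C \<Longrightarrow> A * B * C = A * (B * C)"
  by (rule assoc_mult_mat[of A "dim_row A" "dim_row B" B "dim_row C" C "dim_col C"]) auto

lemma transpose_mult_dim:
  fixes A B :: "'a :: comm_semiring_0 mat"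
  shows "dim_col A = dim_row B \<Longrightarrow> (A * B)\<^sup>T = B\<^sup>T * A\<^sup>T"
  by (rule transpose_mult[of A "dim_row A" "dim_row B" B "dim_col B"]) auto

text \<open>In a right-nested product the pair \<open>A * B\<close> never occurs as a subterm; this
  form cancels it in front of a remaining factor.\<close>

lemma mult_left_cancel_one:
  fixes A B C :: "'a :: semiring_1 mat"
  assumes "A * B = 1\<^sub>m n" "dim_col A = dim_row B" "dim_col B = dim_row C" "dim_row C = n"
  shows "A * (B * C) = C"
  using mult_assoc_dim[of A B C] assms left_mult_one_mat[of C n "dim_col C"] by auto

lemma minus_mult_distrib_dim:
  fixes A B C :: "'a :: ring mat"
  assumes "dim_row A = dim_row B" "dim_col A = dim_col B" "dim_col B = dim_row C"
  shows "(A - B) * C = A * C - B * C"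
  by (rule minus_mult_distrib_mat[of _ "dim_row B" "dim_col B" _ _ "dim_col C"]) (use assms in auto)

lemma mult_minus_distrib_dim:
  fixes A B C :: "'a :: ring mat"
  assumes "dim_row B = dim_row C" "dim_col B = dim_col C" "dim_col A = dim_row B"
  shows "A * (B - C) = A * B - A * C"
  by (rule mult_minus_distrib_mat[where nr = "dim_row A" and n = "dim_row C" and nc = "dim_col C"])
    (use assms in auto)

lemma index_mult_sum:
  fixes A B :: "'a :: semiring_0 mat"
  assumes "i < dim_row A" "j < dim_col B" "dim_col A = dim_row B"
  shows "(A * B) $$ (i, j) = (\<Sum>l<dim_row B. A $$ (i, l) * B $$ (l, j))"
  using assms by (auto simp: scalar_prod_def lessThan_atLeast0 intro!: sum.cong)

lemma diagonal_matD:
  "diagonal_mat D \<Longrightarrow> i < dim_row D \<Longrightarrow> j < dim_col D \<Longrightarrow> i \<noteq> j \<Longrightarrow> D $$ (i, j) = 0"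
  by (simp add: diagonal_mat_def)

lemma diagonal_mult_index:
  fixes D A :: "'a :: semiring_0 mat"
  assumes D: "diagonal_mat D" "D \<in> carrier_mat n n" and "dim_row A = n" "i < n" "j < dim_col A"
  shows "(D * A) $$ (i, j) = D $$ (i, i) * A $$ (i, j)"
proof -
  have "(D * A) $$ (i, j) = (\<Sum>l<n. D $$ (i, l) * A $$ (l, j))"
    using assms by (subst index_mult_sum) auto
  also have "\<dots> = (\<Sum>l<n. if l = i then D $$ (i, i) * A $$ (i, j) else 0)"
  proof (rule sum.cong)
    fix l assume "l \<in> {..<n}"
    then have "l \<noteq> i \<Longrightarrow> D $$ (i, l) = 0" using diagonal_matD[OF D(1)] D(2) \<open>i < n\<close> by simp
    then show "D $$ (i, l) * A $$ (l, j) = (if l = i then D $$ (i, i) * A $$ (i, j) else 0)" by simp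
  qed simp
  finally show ?thesis using \<open>i < n\<close> by simp
qed

lemma mult_diagonal_index:
  fixes D A :: "'a :: semiring_0 mat"
  assumes D: "diagonal_mat D" "D \<in> carrier_mat n n" and "dim_col A = n" "i < dim_row A" "j < n"
  shows "(A * D) $$ (i, j) = A $$ (i, j) * D $$ (j, j)"
proof -
  have "(A * D) $$ (i, j) = (\<Sum>l<n. A $$ (i, l) * D $$ (l, j))"
    using assms by (subst index_mult_sum) auto
  also have "\<dots> = (\<Sum>l<n. if l = j then A $$ (i, j) * D $$ (j, j) else 0)"
  proof (rule sum.cong)
    fix l assume "l \<in> {..<n}"
    then have "l \<noteq> j \<Longrightarrow> D $$ (l, j) = 0" using diagonal_matD[OF D(1)] D(2) \<open>j < n\<close> by simp
    then show "A $$ (i, l) * D $$ (l, j) = (if l = j then A $$ (i, j) * D $$ (j, j) else 0)" by simp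
  qed simp
  finally show ?thesis using \<open>j < n\<close> by simp
qed

lemma transpose_diagonal_square:
  assumes D: "diagonal_mat D" "D \<in> carrier_mat n n"
  shows "D\<^sup>T = D"
proof (rule eq_matI)
  fix i j assume "i < dim_row D" "j < dim_col D"
  then have ij: "i < n" "j < n" using D(2) by auto
  show "D\<^sup>T $$ (i, j) = D $$ (i, j)"
  proof (cases "i = j")
    case False
    then show ?thesis
      using diagonal_matD[OF D(1), of i j] diagonal_matD[OF D(1), of j i] ij D(2) by simp
  qed (use ij D(2) in simp)
qed (use D(2) in auto)

lemma gram_diag_nonneg:
  fixes A :: "real mat"
  assumes "i < dim_row A"
  shows "0 \<le> (A * A\<^sup>T) $$ (i, i)"
  using assms by (subst index_mult_sum) (auto intro!: sum_nonneg)

section \<open>Invariance of the Frobenius norm\<close>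

lemma frobenius_norm_transpose: "frobenius_norm A\<^sup>T = frobenius_norm A"
proof -
  have "(\<Sum>i<dim_col A. \<Sum>j<dim_row A. (A\<^sup>T $$ (i, j))\<^sup>2) =
        (\<Sum>i<dim_col A. \<Sum>j<dim_row A. (A $$ (j, i))\<^sup>2)"
    by (intro sum.cong) auto
  also have "\<dots> = (\<Sum>j<dim_row A. \<Sum>i<dim_col A. (A $$ (j, i))\<^sup>2)"
    by (rule sum.swap)
  finally show ?thesis by (simp add: frobenius_norm_def)
qed

text \<open>Diagonal entries of \<open>A * A\<^sup>T\<close> are squared row lengths. The norm thus
  depends on \<open>A * A\<^sup>T\<close> alone, and invariance under right factors with orthonormal
  rows becomes a cancellation.\<close>

lemma frobenius_norm_gram:
  "frobenius_norm A = sqrt (\<Sum>i<dim_row A. (A * A\<^sup>T) $$ (i, i))"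
  unfolding frobenius_norm_def
  by (intro arg_cong[where f = sqrt] sum.cong refl, subst index_mult_sum)
     (auto simp: power2_eq_square)

lemma frobenius_norm_mult_coisometry:
  assumes "V * V\<^sup>T = 1\<^sub>m n" "dim_col A = n"
  shows "frobenius_norm (A * V) = frobenius_norm A"
proof -
  have n: "dim_row V = n" using arg_cong[OF assms(1), of dim_row] by simp
  have "(A * V) * (A * V)\<^sup>T = A * A\<^sup>T"
    using assms n by (simp add: transpose_mult_dim mult_assoc_dim mult_left_cancel_one[of V])
  then show ?thesis by (simp add: frobenius_norm_gram)
qed

lemma frobenius_norm_isometry_mult:
  assumes "U\<^sup>T * U = 1\<^sub>m n" "dim_row A = n"
  shows "frobenius_norm (U * A) = frobenius_norm A"
proof -
  have n: "dim_col U = n" using arg_cong[OF assms(1), of dim_col] by simp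
  have "frobenius_norm (U * A) = frobenius_norm (A\<^sup>T * U\<^sup>T)"
    using n assms by (metis frobenius_norm_transpose transpose_mult_dim)
  also have "\<dots> = frobenius_norm A"
    using assms by (simp add: frobenius_norm_mult_coisometry[of _ n] frobenius_norm_transpose)
  finally show ?thesis .
qed

section \<open>Squared singular values and the loss of a truncation\<close>

text \<open>The value zero past the diagonal gives sums over \<open>i < k\<close> a meaning for
  every \<open>k\<close> and makes decompositions of different shapes comparable.\<close>

definition sq_sv :: "real mat \<Rightarrow> nat \<Rightarrow> real" where
  "sq_sv S i = (if i < dim_row S \<and> i < dim_col S then (S $$ (i, i))\<^sup>2 else 0)"

lemma sq_sv_nonneg: "0 \<le> sq_sv S i"
  by (simp add: sq_sv_def)

lemma is_svdD:
  assumes "is_svd A U S V"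
  shows "dim_row U = dim_row A" "dim_col U = dim_row S" "dim_row V = dim_col S" "dim_col V = dim_col A"
    "U\<^sup>T * U = 1\<^sub>m (dim_row S)" "V * V\<^sup>T = 1\<^sub>m (dim_col S)" "diagonal_mat S" "A = U * S * V"
    "\<And>i. i < dim_row S \<Longrightarrow> i < dim_col S \<Longrightarrow> 0 \<le> S $$ (i, i)"
    "\<And>i j. j < dim_row S \<Longrightarrow> j < dim_col S \<Longrightarrow> i \<le> j \<Longrightarrow> S $$ (j, j) \<le> S $$ (i, i)"
proof -
  note D = assms[unfolded is_svd_def]
  from D have U: "U \<in> carrier_mat (dim_row A) (dim_row S)" and V: "V \<in> carrier_mat (dim_col S) (dim_col A)"
    by blast+
  show "dim_row U = dim_row A" "dim_col U = dim_row S" using carrier_matD[OF U] .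
  show "dim_row V = dim_col S" "dim_col V = dim_col A" using carrier_matD[OF V] .
  show "U\<^sup>T * U = 1\<^sub>m (dim_row S)" "V * V\<^sup>T = 1\<^sub>m (dim_col S)" "diagonal_mat S" "A = U * S * V"
    using D by blast+
  show "0 \<le> S $$ (i, i)" if "i < dim_row S" "i < dim_col S" for i
    using D that by (metis min_less_iff_conj)
  show "S $$ (j, j) \<le> S $$ (i, i)" if "j < dim_row S" "j < dim_col S" "i \<le> j" for i j
    using D that by (metis min_less_iff_conj)
qed

text \<open>Orthonormal rows of \<open>Z\<close> cancel in \<open>V * Z * (V * Z)\<^sup>T\<close>,
  while \<open>U\<close> and \<open>S\<close> stay the same. This carries a decomposition of the
  whitened weights over to \<open>W * X\<close>.\<close>

lemma is_svd_mult_coisometry: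
  assumes "is_svd A U S V" "Z * Z\<^sup>T = 1\<^sub>m (dim_col A)"
  shows "is_svd (A * Z) U S (V * Z)"
proof -
  note D = is_svdD[OF assms(1)]
  have Z: "dim_row Z = dim_col A" using arg_cong[OF assms(2), of dim_row] by simp
  have "U \<in> carrier_mat (dim_row (A * Z)) (dim_row S)"
    using D(1,2) by (intro carrier_matI) simp_all
  moreover have "V * Z \<in> carrier_mat (dim_col S) (dim_col (A * Z))"
    using D(3) by (intro carrier_matI) simp_all
  moreover have "V * Z * (V * Z)\<^sup>T = 1\<^sub>m (dim_col S)"
    using D(3,4,6) Z by (simp add: transpose_mult_dim mult_assoc_dim mult_left_cancel_one[OF assms(2)])
  moreover have "A * Z = U * S * (V * Z)"
    using D(1-4) Z by (subst D(8)) (simp add: mult_assoc_dim)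
  ultimately show ?thesis
    unfolding is_svd_def using D(5,7,9,10) by (intro conjI allI impI) (simp_all only: min_less_iff_conj)
qed

lemma sq_sv_antimono:
  assumes "is_svd A U S V" "i \<le> j"
  shows "sq_sv S j \<le> sq_sv S i"
  using assms(2) is_svdD(9,10)[OF assms(1)] by (auto simp: sq_sv_def intro!: power_mono)

lemma diagonal_sum_squares:
  assumes "diagonal_mat S" "i < dim_row S"
  shows "(\<Sum>j<dim_col S. (S $$ (i, j))\<^sup>2) = sq_sv S i"
proof -
  have "(\<Sum>j<dim_col S. (S $$ (i, j))\<^sup>2) =
        (\<Sum>j<dim_col S. if j = i then (S $$ (i, i))\<^sup>2 else 0)"
    by (intro sum.cong) (use assms in \<open>auto simp: diagonal_matD\<close>)
  then show ?thesis using assms by (simp add: sq_sv_def)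
qed

lemma diagonal_mat_gram:
  assumes "diagonal_mat S" "i < dim_row S" "j < dim_row S"
  shows "(S * S\<^sup>T) $$ (i, j) = (if i = j then sq_sv S i else 0)"
proof (cases "i = j")
  case True
  have "(S * S\<^sup>T) $$ (i, i) = (\<Sum>j<dim_col S. (S $$ (i, j))\<^sup>2)"
    using assms by (subst index_mult_sum) (auto simp: power2_eq_square)
  then show ?thesis using True assms diagonal_sum_squares by simp
next
  case False
  then have "(\<Sum>l<dim_col S. S $$ (i, l) * S $$ (j, l)) = 0"
    using assms by (intro sum.neutral ballI) (metis diagonal_matD lessThan_iff mult_eq_0_iff)
  then show ?thesis using False assms by (subst index_mult_sum) auto
qed

lemma is_svd_frobenius:
  assumes "is_svd A U S V"
  shows "(frobenius_norm A)\<^sup>2 = (\<Sum>i<dim_row S. sq_sv S i)"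
proof -
  note D = is_svdD[OF assms]
  have A: "A = U * (S * V)"
    using D(8) by (simp only: mult_assoc_dim[OF D(2) D(3)[symmetric]])
  have "frobenius_norm A = frobenius_norm S"
    unfolding A using frobenius_norm_isometry_mult[OF D(5), of "S * V"]
      frobenius_norm_mult_coisometry[OF D(6), of S] by simp
  moreover have "(frobenius_norm S)\<^sup>2 = (\<Sum>i<dim_row S. sq_sv S i)"
    using D(7) by (simp add: frobenius_norm_def diagonal_sum_squares sq_sv_nonneg sum_nonneg)
  ultimately show ?thesis by simp
qed

text \<open>Pythagoras: the orthonormal factors drop out, and the rows of \<open>S\<close> split
  into kept and discarded ones. Since the right side mentions only \<open>A\<close>, comparing
  losses reduces to comparing leading sums.\<close>

lemma is_svd_truncation_loss:
  assumes "is_svd A U S V"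
  shows "(frobenius_norm (A - U * Trunc k S * V))\<^sup>2 + (\<Sum>i<k. sq_sv S i) = (frobenius_norm A)\<^sup>2"
proof -
  let ?R = "S - Trunc k S"
  note D = is_svdD[OF assms]
  have T: "dim_row (Trunc k S) = dim_row S" "dim_col (Trunc k S) = dim_col S"
    by (auto simp: Trunc_def)
  have "A - U * Trunc k S * V = U * (?R * V)"
    using D(2,3) T
    by (subst D(8)) (simp add: mult_assoc_dim minus_mult_distrib_dim mult_minus_distrib_dim)
  then have "frobenius_norm (A - U * Trunc k S * V) = frobenius_norm ?R"
    using T frobenius_norm_isometry_mult[OF D(5), of "?R * V"]
      frobenius_norm_mult_coisometry[OF D(6), of ?R] by simp
  also have "(\<dots>)\<^sup>2 = (\<Sum>i<dim_row S. \<Sum>j<dim_col S. (?R $$ (i, j))\<^sup>2)"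
    using T by (simp add: frobenius_norm_def sum_nonneg)
  also have "\<dots> = (\<Sum>i<dim_row S. if i < k then 0 else sq_sv S i)"
    by (intro sum.cong refl) (auto simp: Trunc_def diagonal_sum_squares[OF D(7), symmetric])
  finally have 1: "(frobenius_norm (A - U * Trunc k S * V))\<^sup>2
      = (\<Sum>i<dim_row S. if i < k then 0 else sq_sv S i)" .
  \<comment> \<open>\<open>k\<close> may exceed the number of rows; the surplus terms are zero by
    the padding in \<open>sq_sv\<close>.\<close>
  have "(\<Sum>i<k. sq_sv S i) = (\<Sum>i\<in>{..<k} \<inter> {..<dim_row S}. sq_sv S i)"
    by (intro sum.mono_neutral_right) (auto simp: sq_sv_def)
  also have "\<dots> = (\<Sum>i<dim_row S. if i < k then sq_sv S i else 0)"
    by (subst Int_commute, subst sum.inter_restrict) auto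
  finally show ?thesis
    unfolding 1 is_svd_frobenius[OF assms]
    by (auto simp flip: sum.distrib intro!: sum.cong)
qed

section \<open>Independence of the loss from the chosen decomposition\<close>

text \<open>Column \<open>j\<close> of \<open>U\<^sup>T * Y\<close> holds the coordinates of a unit
  vector along an orthonormal family. The residual \<open>?Z\<close> after projection has Gram
  matrix \<open>1 - ?Q\<^sup>T * ?Q\<close>, whose diagonal is nonnegative.\<close>

lemma bessel_column:
  fixes U Y :: "real mat"
  assumes "U\<^sup>T * U = 1\<^sub>m r" "Y\<^sup>T * Y = 1\<^sub>m s" "dim_row U = dim_row Y" "j < s"
  shows "(\<Sum>i<r. ((U\<^sup>T * Y) $$ (i, j))\<^sup>2) \<le> 1"
proof -
  let ?Q = "U\<^sup>T * Y" and ?Z = "Y - U * (U\<^sup>T * Y)"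
  have r: "dim_col U = r" using arg_cong[OF assms(1), of dim_col] by simp
  have s: "dim_col Y = s" using arg_cong[OF assms(2), of dim_col] by simp
  \<comment> \<open>The residual is orthogonal to the columns of \<open>U\<close>, so only
    \<open>Y\<^sup>T * ?Z\<close> survives in its Gram matrix.\<close>
  have UZ: "U\<^sup>T * ?Z = 0\<^sub>m r s"
    using assms(3) r s
    by (subst mult_minus_distrib_dim) (auto simp: mult_left_cancel_one[OF assms(1)])
  have "?Z\<^sup>T * ?Z = (Y\<^sup>T - ?Q\<^sup>T * U\<^sup>T) * ?Z"
    using assms(3) r s
    by (subst transpose_minus[of _ "dim_row Y" s]) (auto simp: transpose_mult_dim)
  also have "\<dots> = Y\<^sup>T * ?Z - ?Q\<^sup>T * U\<^sup>T * ?Z"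
    using assms(3) r s by (intro minus_mult_distrib_dim) auto
  also have "?Q\<^sup>T * U\<^sup>T * ?Z = 0\<^sub>m s s"
    using assms(3) r s UZ
    by (subst mult_assoc_dim) auto
  also have "Y\<^sup>T * ?Z = 1\<^sub>m s - Y\<^sup>T * (U * (U\<^sup>T * Y))"
    using assms(2,3) r s by (subst mult_minus_distrib_dim) auto
  also have "Y\<^sup>T * (U * (U\<^sup>T * Y)) = ?Q\<^sup>T * ?Q"
    using assms(3) r s by (simp add: transpose_mult_dim mult_assoc_dim)
  finally have Z: "?Z\<^sup>T * ?Z = 1\<^sub>m s - ?Q\<^sup>T * ?Q - 0\<^sub>m s s" .
  have "0 \<le> (?Z\<^sup>T * ?Z) $$ (j, j)"
    using gram_diag_nonneg[of j "?Z\<^sup>T"] assms(3,4) r s by simp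
  also have "\<dots> = 1 - (?Q\<^sup>T * ?Q) $$ (j, j)"
    unfolding Z using assms(4) r s by simp
  also have "(?Q\<^sup>T * ?Q) $$ (j, j) = (\<Sum>i<r. (?Q $$ (i, j))\<^sup>2)"
    using assms(3,4) r s
    by (subst index_mult_sum) (auto simp: power2_eq_square)
  finally show ?thesis by simp
qed

text \<open>With weights capped at one and total at most \<open>k\<close>, the best choice is full
  weight on the \<open>k\<close> largest values. The proof compares \<open>w\<close> with the
  indicator \<open>?e\<close> of the first \<open>k\<close> indices.\<close>

lemma weighted_sum_le_leading_sum:
  fixes a w :: "nat \<Rightarrow> real"
  assumes "\<And>i j. i \<le> j \<Longrightarrow> a j \<le> a i" "\<And>i. 0 \<le> a i"
    and "\<And>i. i < r \<Longrightarrow> 0 \<le> w i" "\<And>i. i < r \<Longrightarrow> w i \<le> 1" "(\<Sum>i<r. w i) \<le> real k"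
    and "\<And>i. r \<le> i \<Longrightarrow> a i = 0"
  shows "(\<Sum>i<r. a i * w i) \<le> (\<Sum>i<k. a i)"
proof -
  let ?e = "\<lambda>i. if i < k then 1 else (0::real)"
  let ?v = "\<lambda>i. if i < r then w i else 0"
  \<comment> \<open>A common range containing both the first \<open>k\<close> and the first
    \<open>r\<close> indices; \<open>?v\<close> extends \<open>w\<close> by zero.\<close>
  let ?N = "k + r"
  \<comment> \<open>With \<open>a k\<close> as pivot the two factors have opposite signs on either
    side of \<open>k\<close>.\<close>
  have "(a i - a k) * (?v i - ?e i) \<le> 0" for i
  proof (cases "i < k")
    case True
    then have "a k \<le> a i" "?v i \<le> 1" using assms(1)[of i k] assms(4)[of i] by auto
    then show ?thesis using True by (simp add: mult_nonneg_nonpos)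
  next
    case False
    then have "a i \<le> a k" "0 \<le> ?v i" using assms(1)[of k i] assms(3)[of i] by auto
    then show ?thesis using False by (simp add: mult_nonpos_nonneg)
  qed
  then have "(\<Sum>i<?N. (a i - a k) * (?v i - ?e i)) \<le> 0"
    by (intro sum_nonpos) auto
  also have "(\<Sum>i<?N. (a i - a k) * (?v i - ?e i)) =
     (\<Sum>i<?N. a i * ?v i) - (\<Sum>i<?N. a i * ?e i) - a k * ((\<Sum>i<?N. ?v i) - (\<Sum>i<?N. ?e i))"
    by (simp add: algebra_simps sum_subtractf sum.distrib sum_distrib_left)
  also have "(\<Sum>i<?N. a i * ?v i) = (\<Sum>i<r. a i * w i)"
    by (intro sum.mono_neutral_cong_right) auto
  also have "(\<Sum>i<?N. a i * ?e i) = (\<Sum>i<k. a i)"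
    by (intro sum.mono_neutral_cong_right) auto
  also have "(\<Sum>i<?N. ?v i) = (\<Sum>i<r. w i)"
    by (intro sum.mono_neutral_cong_right) auto
  also have "(\<Sum>i<?N. ?e i) = (\<Sum>i<k. 1)"
    by (intro sum.mono_neutral_cong_right) auto
  finally have "(\<Sum>i<r. a i * w i) - (\<Sum>i<k. a i) \<le> a k * ((\<Sum>i<r. w i) - real k)"
    by simp
  also have "\<dots> \<le> 0" using assms(2)[of k] assms(5) by (simp add: mult_nonneg_nonpos)
  finally show ?thesis by simp
qed

text \<open>Both decompositions diagonalise \<open>A * A\<^sup>T\<close>, so each squared value of
  \<open>S'\<close> is a combination of those of \<open>S\<close> with coefficients the squared
  entries of a column of \<open>?Q\<close>. Summed over the leading columns, these coefficients are
  admissible weights for \<open>weighted_sum_le_leading_sum\<close>.\<close>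

lemma leading_sq_sv_le:
  assumes "is_svd A U S V" "is_svd A U' S' V'"
  shows "(\<Sum>j<k. sq_sv S' j) \<le> (\<Sum>i<k. sq_sv S i)"
proof -
  let ?r = "dim_row S" and ?r' = "dim_row S'" and ?Q = "U\<^sup>T * U'"
  \<comment> \<open>\<open>S'\<close> may have fewer than \<open>k\<close> rows, and
    \<open>?Q\<close> has only \<open>?r'\<close> columns.\<close>
  let ?K = "min k ?r'"
  note D = is_svdD[OF assms(1)] and D' = is_svdD[OF assms(2)]
  note d = D(7) and UV = D(5,6) and dims = D(1-3)
  note d' = D'(7) and UV' = D'(5,6) and dims' = D'(1-3)
  have "A * A\<^sup>T = U * (S * S\<^sup>T) * U\<^sup>T"
    using dims by (subst (1 2) D(8)) (simp add: transpose_mult_dim mult_assoc_dim mult_left_cancel_one[OF UV(2)])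
  moreover have "A * A\<^sup>T = U' * (S' * S'\<^sup>T) * U'\<^sup>T"
    using dims' by (subst (1 2) D'(8)) (simp add: transpose_mult_dim mult_assoc_dim mult_left_cancel_one[OF UV'(2)])
  \<comment> \<open>Conjugation by \<open>U'\<close> isolates \<open>S' * S'\<^sup>T\<close> on one
    side and produces \<open>?Q\<close> on the other.\<close>
  ultimately have "U'\<^sup>T * (U' * (S' * S'\<^sup>T) * U'\<^sup>T) * U' = U'\<^sup>T * (U * (S * S\<^sup>T) * U\<^sup>T) * U'"
    by simp
  moreover have "U'\<^sup>T * (U' * (S' * S'\<^sup>T) * U'\<^sup>T) * U' = S' * S'\<^sup>T"
    using dims' UV' right_mult_one_mat[of "S'\<^sup>T" "dim_col S'" ?r']
    by (simp add: mult_assoc_dim mult_left_cancel_one[OF UV'(1)])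
  moreover have "U'\<^sup>T * (U * (S * S\<^sup>T) * U\<^sup>T) * U' = ?Q\<^sup>T * ((S * S\<^sup>T) * ?Q)"
    using dims dims' by (simp add: transpose_mult_dim mult_assoc_dim)
  ultimately have G: "S' * S'\<^sup>T = ?Q\<^sup>T * ((S * S\<^sup>T) * ?Q)" by simp
  have diagG: "diagonal_mat (S * S\<^sup>T)"
    using d by (auto simp: diagonal_mat_def diagonal_mat_gram simp del: index_mult_mat(1))
  have sv': "sq_sv S' j = (\<Sum>i<?r. sq_sv S i * (?Q $$ (i, j))\<^sup>2)" if "j < ?r'" for j
  proof -
    have "sq_sv S' j = (S' * S'\<^sup>T) $$ (j, j)"
      using that by (simp add: diagonal_mat_gram[OF d'] del: index_mult_mat(1))
    also have "\<dots> = (\<Sum>i<?r. ?Q $$ (i, j) * ((S * S\<^sup>T) * ?Q) $$ (i, j))"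
      unfolding G using that dims dims'
      by (subst index_mult_sum) (auto simp del: index_mult_mat(1))
    also have "\<dots> = (\<Sum>i<?r. sq_sv S i * (?Q $$ (i, j))\<^sup>2)"
      using that dims dims'
      by (intro sum.cong refl, subst diagonal_mult_index[OF diagG, of ?r])
         (auto simp: diagonal_mat_gram[OF d] power2_eq_square simp del: index_mult_mat(1))
    finally show ?thesis .
  qed
  \<comment> \<open>Rows of \<open>?Q\<close> are columns of \<open>U'\<^sup>T * U\<close>, so
    Bessel applies with the two families exchanged. Rows bound the single weights, columns their
    total.\<close>
  have Qrow: "(\<Sum>j<?r'. (?Q $$ (i, j))\<^sup>2) \<le> 1" if "i < ?r" for i
  proof -
    have "(\<Sum>j<?r'. (?Q $$ (i, j))\<^sup>2) = (\<Sum>j<?r'. ((U'\<^sup>T * U) $$ (j, i))\<^sup>2)"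
      using that dims dims'
      by (intro sum.cong refl) (auto simp: index_mult_sum mult.commute simp del: index_mult_mat(1))
    also have "\<dots> \<le> 1"
      using bessel_column[OF UV'(1) UV(1)] that dims dims' by simp
    finally show ?thesis .
  qed
  have Qcol: "(\<Sum>i<?r. (?Q $$ (i, j))\<^sup>2) \<le> 1" if "j < ?r'" for j
    using bessel_column[OF UV(1) UV'(1)] that dims dims' by simp
  have "(\<Sum>j<k. sq_sv S' j) = (\<Sum>j<?K. sq_sv S' j)"
    by (intro sum.mono_neutral_right) (auto simp: sq_sv_def)
  also have "\<dots> = (\<Sum>j<?K. \<Sum>i<?r. sq_sv S i * (?Q $$ (i, j))\<^sup>2)"
    by (intro sum.cong refl sv') auto
  also have "\<dots> = (\<Sum>i<?r. sq_sv S i * (\<Sum>j<?K. (?Q $$ (i, j))\<^sup>2))"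
    by (subst sum.swap) (simp add: sum_distrib_left)
  also have "\<dots> \<le> (\<Sum>i<k. sq_sv S i)"
  proof (rule weighted_sum_le_leading_sum)
    show "(\<Sum>j<?K. (?Q $$ (i, j))\<^sup>2) \<le> 1" if "i < ?r" for i
    proof -
      have "(\<Sum>j<?K. (?Q $$ (i, j))\<^sup>2) \<le> (\<Sum>j<?r'. (?Q $$ (i, j))\<^sup>2)"
        by (intro sum_mono2) auto
      with Qrow[OF that] show ?thesis by simp
    qed
    have "(\<Sum>i<?r. \<Sum>j<?K. (?Q $$ (i, j))\<^sup>2) = (\<Sum>j<?K. \<Sum>i<?r. (?Q $$ (i, j))\<^sup>2)"
      by (rule sum.swap)
    also have "\<dots> \<le> (\<Sum>j<?K. 1)"
      by (intro sum_mono Qcol) auto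
    finally show "(\<Sum>i<?r. \<Sum>j<?K. (?Q $$ (i, j))\<^sup>2) \<le> real k" by simp
  qed (use assms(1) sq_sv_antimono in \<open>auto simp: sq_sv_nonneg sum_nonneg sq_sv_def\<close>)
  finally show ?thesis .
qed

text \<open>The preceding inequality holds in both directions, so the leading sums agree. Norms are
  nonnegative, hence equal squares suffice.\<close>

lemma is_svd_truncation_loss_unique:
  assumes "is_svd A U S V" "is_svd A U' S' V'"
  shows "frobenius_norm (A - U * Trunc k S * V) = frobenius_norm (A - U' * Trunc k S' * V')"
proof -
  have "(\<Sum>i<k. sq_sv S i) = (\<Sum>i<k. sq_sv S' i)"
    using leading_sq_sv_le assms by (intro antisym) blast+
  then have "(frobenius_norm (A - U * Trunc k S * V))\<^sup>2 = (frobenius_norm (A - U' * Trunc k S' * V'))\<^sup>2"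
    using is_svd_truncation_loss[OF assms(1), of k] is_svd_truncation_loss[OF assms(2), of k] by simp
  moreover have "0 \<le> frobenius_norm B" for B
    by (simp add: frobenius_norm_def sum_nonneg)
  ultimately show ?thesis by simp
qed

section \<open>Rigidity of a diagonal polar form\<close>

text \<open>With a symmetric positive semidefinite \<open>H = S P\<close> we get \<open>H\<^sup>2 = H H\<^sup>T = S\<^sup>2\<close>, so \<open>H\<close> commutes
  with \<open>S\<^sup>2\<close>, hence with \<open>S\<close>, and \<open>(H + S) (H - S) = 0\<close> with \<open>H + S\<close> positive definite.\<close>

lemma gram_polar_diagonal:
  fixes K S P :: "real mat"
  assumes K: "K \<in> carrier_mat n p" and S: "S \<in> carrier_mat n n" and P: "P \<in> carrier_mat n n"
    and d: "diagonal_mat S" and pos: "\<And>i. i < n \<Longrightarrow> 0 < S $$ (i, i)"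
    and orth: "P * P\<^sup>T = 1\<^sub>m n" and eq: "K * K\<^sup>T = S * P"
  shows "K * K\<^sup>T = S"
proof -
  define H where "H = K * K\<^sup>T"
  define E where "E = H - S"
  have H: "H \<in> carrier_mat n n" using K by (simp add: H_def)
  have E: "E \<in> carrier_mat n n" using S H by (auto simp: E_def)
  have ST: "S\<^sup>T = S" using S d by (intro transpose_diagonal_square[of _ n]) auto
  have HT: "H\<^sup>T = H" using K by (simp add: H_def transpose_mult_dim)
  have "H * H = H * H\<^sup>T" by (simp only: HT)
  also have "\<dots> = S * (P * (P\<^sup>T * S))" unfolding H_def eq using S P
    by (simp add: transpose_mult_dim mult_assoc_dim ST)
  also have "\<dots> = S * S" using S P orth
    by (subst mult_left_cancel_one[OF orth]) auto
  finally have HH: "H * H = S * S" .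
  have comm2: "H * (S * S) = S * (S * H)"
    using HH H S by (metis mult_assoc_dim carrier_matD)
  have HS: "H * S = S * H"
  proof (rule eq_matI)
    fix i j assume "i < dim_row (S * H)" "j < dim_col (S * H)"
    then have ij: "i < n" "j < n" using S H by auto
    let ?h = "H $$ (i, j)" and ?s = "S $$ (i, i)" and ?t = "S $$ (j, j)"
    have "(H * S * S) $$ (i, j) = ?h * ?t * ?t"
      using ij S H d by (simp add: mult_diagonal_index[of S n] del: index_mult_mat(1) assoc_mult_mat)
    moreover have "(S * (S * H)) $$ (i, j) = ?s * (?s * ?h)"
      using ij S H d by (simp add: diagonal_mult_index[of S n] del: index_mult_mat(1))
    moreover have "H * S * S = S * (S * H)"
      using comm2 H S by (metis mult_assoc_dim carrier_matD)
    ultimately have "?h * ?t * ?t = ?s * (?s * ?h)" by (simp only:)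
    \<comment> \<open>Commuting with the square gives only
      \<open>?h * (?t * ?t - ?s * ?s) = 0\<close>; the factor \<open>?t + ?s\<close> is positive and
      can be removed.\<close>
    moreover have "?h * ((?t - ?s) * (?t + ?s)) = ?h * ?t * ?t - ?s * (?s * ?h)"
      by (simp add: algebra_simps)
    ultimately have "?h * ((?t - ?s) * (?t + ?s)) = 0" by linarith
    then have "?h * ?t = ?s * ?h"
      using pos[OF ij(1)] pos[OF ij(2)] by auto
    then show "(H * S) $$ (i, j) = (S * H) $$ (i, j)"
      using ij S H d by (simp add: mult_diagonal_index[of S n] diagonal_mult_index[of S n] del: index_mult_mat(1))
  qed (use S H in auto)
  have "H * E + S * E = (S * S - S * H) + (S * H - S * S)"
    unfolding E_def using H S HH HS by (simp add: mult_minus_distrib_mat[of _ n n _ n])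
  also have "\<dots> = 0\<^sub>m n n" using S H by (intro eq_matI) (auto simp del: index_mult_mat(1))
  finally have "E\<^sup>T * (H * E + S * E) = 0\<^sub>m n n" using E by simp
  moreover have "E\<^sup>T * (H * E + S * E) = E\<^sup>T * (H * E) + E\<^sup>T * (S * E)"
    by (rule mult_add_distrib_mat[of _ n n _ n]) (use E S H in auto)
  \<comment> \<open>The Gram form of \<open>H\<close> makes the first summand of the quadratic form
    nonnegative on the diagonal. The second is a sum of squares with positive weights, so a zero
    total forces \<open>E\<close> to vanish.\<close>
  moreover have "E\<^sup>T * (H * E) = (E\<^sup>T * K) * (E\<^sup>T * K)\<^sup>T"
    unfolding H_def using E K by (simp add: transpose_mult_dim mult_assoc_dim)
  ultimately have Z: "(E\<^sup>T * K) * (E\<^sup>T * K)\<^sup>T + E\<^sup>T * (S * E) = 0\<^sub>m n n" by (simp only:)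
  have E0: "E $$ (i, j) = 0" if ij: "i < n" "j < n" for i j
  proof -
    have 1: "((E\<^sup>T * K) * (E\<^sup>T * K)\<^sup>T) $$ (j, j) + (E\<^sup>T * (S * E)) $$ (j, j) = 0"
      using arg_cong[OF Z, of "\<lambda>M. M $$ (j, j)"] ij E K S by (simp del: index_mult_mat(1))
    have "0 \<le> ((E\<^sup>T * K) * (E\<^sup>T * K)\<^sup>T) $$ (j, j)"
      using gram_diag_nonneg[of j "E\<^sup>T * K"] ij E S by simp
    moreover have "(E\<^sup>T * (S * E)) $$ (j, j) = (\<Sum>l<n. S $$ (l, l) * (E $$ (l, j))\<^sup>2)"
    proof (subst index_mult_sum)
      show "(\<Sum>l<dim_row (S * E). E\<^sup>T $$ (j, l) * (S * E) $$ (l, j)) =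
          (\<Sum>l<n. S $$ (l, l) * (E $$ (l, j))\<^sup>2)"
      proof (intro sum.cong)
        fix l assume "l \<in> {..<n}"
        then have l: "l < n" by simp
        have "(S * E) $$ (l, j) = S $$ (l, l) * E $$ (l, j)"
          using l ij E S d by (intro diagonal_mult_index[of _ n]) auto
        moreover have "E\<^sup>T $$ (j, l) = E $$ (l, j)"
          using l ij E by (intro index_transpose_mat) auto
        ultimately show "E\<^sup>T $$ (j, l) * (S * E) $$ (l, j) = S $$ (l, l) * (E $$ (l, j))\<^sup>2"
          by (simp add: power2_eq_square)
      qed (use S in auto)
    qed (use E S ij in auto)
    ultimately have "(\<Sum>l<n. S $$ (l, l) * (E $$ (l, j))\<^sup>2) \<le> 0" using 1 by linarith
    moreover have nn: "0 \<le> S $$ (l, l) * (E $$ (l, j))\<^sup>2" if "l < n" for l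
      using pos[OF that] by simp
    moreover have "S $$ (i, i) * (E $$ (i, j))\<^sup>2 \<le> (\<Sum>l<n. S $$ (l, l) * (E $$ (l, j))\<^sup>2)"
      using ij nn by (intro member_le_sum) auto
    ultimately have "S $$ (i, i) * (E $$ (i, j))\<^sup>2 = 0"
      using nn[OF ij(1)] by linarith
    then show ?thesis using pos[OF ij(1)] by auto
  qed
  have "H = S"
  proof (rule eq_matI)
    fix i j assume "i < dim_row S" "j < dim_col S"
    then have ij: "i < n" "j < n" using S by auto
    then show "H $$ (i, j) = S $$ (i, j)"
      using E0[OF ij] S H by (simp add: E_def)
  qed (use S H in auto)
  then show ?thesis by (simp add: H_def)
qed

section \<open>Matrix inverses and the whitening argument\<close>

text \<open>A left inverse of a square matrix over a field is also a right inverse, so the result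
  \<open>None\<close> is impossible; any returned \<open>C\<close> is a right inverse and agrees
  with \<open>B\<close>.\<close>

lemma mat_inv_eqI:
  assumes A: "A \<in> carrier_mat n n" and B: "B \<in> carrier_mat n n" and BA: "B * A = 1\<^sub>m n"
  shows "mat_inv A = B"
proof (cases "mat_inverse A")
  case None
  have "A * B = 1\<^sub>m n" by (rule mat_mult_left_right_inverse[OF B A BA])
  with None show ?thesis
    using mat_inverse(1)[OF A, where b = n] A B BA by (auto simp: Units_def ring_mat_def)
next
  case (Some C)
  from mat_inverse(2)[OF A Some] have C: "A * C = 1\<^sub>m n" "C \<in> carrier_mat n n" by auto
  have "B = B * (A * C)" using C B by simp
  also have "\<dots> = C" using BA A B C by (subst mult_left_cancel_one) auto
  finally show ?thesis using Some by (simp add: mat_inv_def)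
qed

lemma invertible_mat_carrierE:
  fixes T :: "'a :: semiring_1 mat"
  assumes "invertible_mat T" "T \<in> carrier_mat n n"
  obtains N where "N \<in> carrier_mat n n" "N * T = 1\<^sub>m n" "T * N = 1\<^sub>m n"
proof -
  obtain N where N: "T * N = 1\<^sub>m n" "N * T = 1\<^sub>m (dim_row N)"
    using assms by (auto simp: invertible_mat_def inverts_mat_def)
  have "dim_col N = n" using arg_cong[OF N(1), of dim_col] by simp
  moreover have "dim_row N = n" using arg_cong[OF N(2), of dim_col] assms(2) by simp
  ultimately show thesis using N that by auto
qed

text \<open>Invertibility of \<open>map_mat sqrt Ss\<close> gives the inverse in the formula its
  meaning. \<open>C'\<close> is an arbitrary truncation of \<open>W * X\<close>, so the equality
  holds for whichever decomposition defines the minimum.\<close>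

theorem theorem3p1:
  fixes W X Us Ss Vs Uws Sws Vws W' C' :: "real mat"
    and m n p k :: nat
  assumes "W \<in> carrier_mat m n"
    and "X \<in> carrier_mat n p"
    and "is_svd (X * X\<^sup>T) Us Ss Vs"
    and "Us \<in> carrier_mat n n"
    and "invertible_mat (map_mat sqrt Ss)"
    and "is_svd (W * Us * map_mat sqrt Ss) Uws Sws Vws"
    and "W' = Uws * Trunc k Sws * Vws * mat_inv (map_mat sqrt Ss) * mat_inv Us"
    and "is_svd_truncation k (W * X) C'"
  shows "frobenius_norm (W * X - W' * X) = frobenius_norm (W * X - C')"
proof -
  let ?T = "map_mat sqrt Ss"
  note W = assms(1) and X = assms(2) and Us = assms(4)
  have "dim_row Ss = n" using is_svdD(2)[OF assms(3)] assms(4) by simp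
  \<comment> \<open>\<open>is_svd\<close> also admits a rectangular \<open>Ss\<close>; invertibility
    makes it square.\<close>
  then have S: "Ss \<in> carrier_mat n n" using assms(5) by (auto simp: invertible_mat_def)
  then have T: "?T \<in> carrier_mat n n" by simp
  have d: "diagonal_mat Ss" and nn: "\<And>i. i < n \<Longrightarrow> 0 \<le> Ss $$ (i, i)"
    and UU: "Us\<^sup>T * Us = 1\<^sub>m n" and VV: "Vs * Vs\<^sup>T = 1\<^sub>m n"
    and XX: "X * X\<^sup>T = Us * Ss * Vs"
    using is_svdD(5-9)[OF assms(3)] S by auto
  have Vs: "Vs \<in> carrier_mat n n"
    using is_svdD(3,4)[OF assms(3)] S X by (intro carrier_matI) auto
  have UU': "Us * Us\<^sup>T = 1\<^sub>m n" using UU Us by (subst mat_mult_left_right_inverse[of "Us\<^sup>T" n Us]) simp_all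
  \<comment> \<open>The entrywise root keeps the off-diagonal zeros because
    \<open>sqrt 0 = 0\<close>.\<close>
  have dT: "diagonal_mat ?T" using d by (auto simp: diagonal_mat_def)
  have TT: "?T\<^sup>T = ?T" using dT T by (intro transpose_diagonal_square[of _ n]) auto
  have T2: "?T * ?T = Ss"
  proof (rule eq_matI)
    fix i j assume "i < dim_row Ss" "j < dim_col Ss"
    then have ij: "i < n" "j < n" using S by auto
    then have "(?T * ?T) $$ (i, j) = sqrt (Ss $$ (i, i)) * sqrt (Ss $$ (i, j))"
      using S T by (subst diagonal_mult_index[OF dT T]) simp_all
    also have "\<dots> = Ss $$ (i, j)"
      using ij S nn[OF ij(1)] diagonal_matD[OF d, of i j] by (cases "i = j") simp_all
    finally show "(?T * ?T) $$ (i, j) = Ss $$ (i, j)" .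
  qed (use S in auto)
  obtain N where N: "N \<in> carrier_mat n n" "N * ?T = 1\<^sub>m n" "?T * N = 1\<^sub>m n"
    using invertible_mat_carrierE[OF assms(5) T] .
  \<comment> \<open>A zero singular value would make the diagonal entry of \<open>N * ?T\<close>
    zero instead of one.\<close>
  have pos: "0 < Ss $$ (i, i)" if "i < n" for i
  proof -
    have "N $$ (i, i) * ?T $$ (i, i) = (N * ?T) $$ (i, i)"
      using that N T by (intro mult_diagonal_index[OF dT T, symmetric]) auto
    also have "\<dots> = 1" using that N by simp
    finally have "Ss $$ (i, i) \<noteq> 0" using that S by auto
    with nn[OF that] show ?thesis by simp
  qed
  \<comment> \<open>The decomposition does not say that \<open>Vs\<close> is
    \<open>Us\<^sup>T\<close>. Changing basis by \<open>Us\<close> leaves \<open>Ss\<close> times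
    the orthogonal matrix \<open>Vs * Us\<close>, the form treated by
    \<open>gram_polar_diagonal\<close>.\<close>
  have "(Us\<^sup>T * X) * (Us\<^sup>T * X)\<^sup>T = Us\<^sup>T * (X * X\<^sup>T) * Us"
    using X Us by (simp add: transpose_mult_dim mult_assoc_dim)
  also have "\<dots> = Ss * (Vs * Us)"
    unfolding XX using S Us Vs by (simp add: mult_assoc_dim mult_left_cancel_one[OF UU])
  finally have gram: "(Us\<^sup>T * X) * (Us\<^sup>T * X)\<^sup>T = Ss * (Vs * Us)" .
  have K: "(Us\<^sup>T * X) * (Us\<^sup>T * X)\<^sup>T = Ss"
  proof (rule gram_polar_diagonal[OF _ S _ d pos _ gram])
    show "Vs * Us * (Vs * Us)\<^sup>T = 1\<^sub>m n"
      using Us Vs VV by (simp add: transpose_mult_dim mult_assoc_dim mult_left_cancel_one[OF UU'])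
  qed (use Us Vs X in auto)
  \<comment> \<open>The whitened activation: \<open>Us\<^sup>T * X\<close> has Gram matrix
    \<open>Ss = ?T * ?T\<close>, which the two factors \<open>N\<close> and \<open>N\<^sup>T\<close>
    normalise to the identity.\<close>
  define Z where "Z = N * (Us\<^sup>T * X)"
  have Z: "Z \<in> carrier_mat n p" using N Us X by (simp add: Z_def)
  have NT: "?T * N\<^sup>T = 1\<^sub>m n"
    using N T TT by (metis transpose_mult transpose_one)
  have "Z * Z\<^sup>T = N * ((Us\<^sup>T * X) * (Us\<^sup>T * X)\<^sup>T) * N\<^sup>T"
    unfolding Z_def using N Us X by (simp add: transpose_mult_dim mult_assoc_dim)
  also have "\<dots> = N * (?T * ?T) * N\<^sup>T"
    by (simp only: K T2)
  also have "\<dots> = N * (?T * (?T * N\<^sup>T))"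
    using N T by (simp add: mult_assoc_dim)
  also have "\<dots> = 1\<^sub>m n"
    using N T by (simp add: NT)
  finally have ZZ: "Z * Z\<^sup>T = 1\<^sub>m n" .
  let ?M = "W * Us * ?T"
  have MZ: "?M * Z = W * X"
    unfolding Z_def using W Us S N X
    by (simp add: mult_assoc_dim mult_left_cancel_one[OF N(3)] mult_left_cancel_one[OF UU'])
  have svd: "is_svd (W * X) Uws Sws (Vws * Z)"
    using is_svd_mult_coisometry[OF assms(6), of Z] ZZ S by (simp only: MZ) simp
  have "mat_inv ?T = N" using T N by (intro mat_inv_eqI) auto
  moreover have "mat_inv Us = Us\<^sup>T" using Us UU by (intro mat_inv_eqI) auto
  moreover have "dim_row (Trunc k Sws) = dim_row Sws" "dim_col (Trunc k Sws) = dim_col Sws"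
    by (auto simp: Trunc_def)
  moreover have "dim_col Uws = dim_row Sws" "dim_row Vws = dim_col Sws" "dim_col Vws = n"
    using is_svdD(2-4)[OF assms(6)] S by auto
  \<comment> \<open>Both inverses are genuine, and the tail \<open>N * (Us\<^sup>T * X)\<close> is
    \<open>Z\<close>. Thus \<open>W' * X\<close> is the truncation belonging to
    \<open>svd\<close>.\<close>
  ultimately have W'X: "W' * X = Uws * Trunc k Sws * (Vws * Z)"
    unfolding assms(7) Z_def using N Us X by (simp add: mult_assoc_dim)
  obtain U S V where "is_svd (W * X) U S V" "C' = U * Trunc k S * V"
    using assms(8) by (auto simp: is_svd_truncation_def)
  then show ?thesis
    unfolding W'X using is_svd_truncation_loss_unique[OF svd] by simp
qed

end
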